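(* Let $n\ge 2$ and let $k$ be an odd positive integer. Then every matrix in $M_n(\mathbb F_2)$ is of the form $A^k+B^k$ with $A,B\in M_n(\mathbb F_2)$. *)

theory Defs
  imports "HOL-Library.Z2" "Jordan_Normal_Form.Matrix"
begin

end

theory Submission
  imports Defs "Jordan_Normal_Form.Column_Operations"
begin

text \<open>
  Over \<open>\<bbbF>\<^sub>2\<close>, if \<open>A (A + 1)\<^sup>r = 0\<close> then, by Frobenius, \<open>A\<close> raised to the power \<open>2\<^sup>r + 1\<close> is \<open>A\<close>,
  so \<open>A\<close> is a \<open>k\<close>-th power for every odd \<open>k\<close>. Hence it suffices to write \<open>M\<close> as a sum of two
  such matrices, and this may be done up to similarity.
  Conjugating \<open>M\<close> by \<open>1 + E\<^sub>i\<^sub>j\<close> adds \<open>M\<^sub>j\<^sub>i\<close> to the diagonal entries \<open>i\<close> and \<open>j\<close> and leaves the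
  others alone. So when the number of ones on the diagonal is minimal in the similarity class,
  the block of \<open>M\<close> on the set of indices \<open>i\<close> with \<open>M\<^sub>i\<^sub>i = 1\<close> is the identity. Up to the order of
  the basis, \<open>M\<close> then consists of the blocks \<open>P, Q\<close> above \<open>R, 1\<close>, where \<open>P\<close> has zero diagonal. Write
  \<open>P = U + L\<close> with \<open>U\<close> upper and \<open>L\<close> lower unitriangular; \<open>M\<close> is the sum of the matrix with blocks
  \<open>U, Q\<close> above \<open>0, 1\<close> and the matrix with blocks \<open>L, 0\<close> above \<open>R, 0\<close>.
\<close>

lemma pow_mat_add:
  fixes A :: "'a :: semiring_1 mat"
  assumes A: "A \<in> carrier_mat n n"
  shows "A ^\<^sub>m (a + b) = A ^\<^sub>m a * A ^\<^sub>m b"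
proof (induction b)
  case 0
  show ?case using A by simp
next
  case (Suc b)
  then show ?case
    using A by (simp add: assoc_mult_mat[of _ n n _ n _ n])
qed

lemma pow_mat_mult:
  fixes A :: "'a :: semiring_1 mat"
  assumes A: "A \<in> carrier_mat n n"
  shows "A ^\<^sub>m (a * b) = (A ^\<^sub>m a) ^\<^sub>m b"
proof (induction b)
  case 0
  show ?case using A by simp
next
  case (Suc b)
  have "A ^\<^sub>m (a * Suc b) = A ^\<^sub>m (a * b + a)" by (simp add: add.commute)
  then show ?case using Suc A by (simp only: pow_mat_add pow_mat.simps)
qed

lemma bit_mat_plus_one_pow_two_pow:
  fixes A :: "bit mat"
  assumes A: "A \<in> carrier_mat n n"
  shows "(A + 1\<^sub>m n) ^\<^sub>m (2 ^ m) = A ^\<^sub>m (2 ^ m) + 1\<^sub>m n"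
proof (induction m)
  case 0
  show ?case using A by simp
next
  case (Suc m)
  define X where "X = A ^\<^sub>m (2 ^ m)"
  have X: "X \<in> carrier_mat n n" using A by (simp add: X_def)
  have A1: "A + 1\<^sub>m n \<in> carrier_mat n n" using A by simp
  have "(A + 1\<^sub>m n) ^\<^sub>m (2 ^ Suc m) = (X + 1\<^sub>m n) * (X + 1\<^sub>m n)"
    using pow_mat_add[OF A1, of "2 ^ m" "2 ^ m"] Suc by (simp add: X_def mult_2)
  also have "\<dots> = X * X + X + (X + 1\<^sub>m n)"
    using X by (simp add: add_mult_distrib_mat[of _ n n _ _ n] mult_add_distrib_mat[of _ n n _ n])
  \<comment> \<open>The cross terms \<open>X + X\<close> cancel entrywise in characteristic
    2.\<close>
  also have "\<dots> = X * X + 1\<^sub>m n"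
    using X by (intro eq_matI) (auto simp del: index_mult_mat(1))
  also have "X * X = A ^\<^sub>m (2 ^ Suc m)"
    using pow_mat_add[OF A, of "2 ^ m" "2 ^ m"] by (simp add: X_def mult_2)
  finally show ?case .
qed

lemma bit_mat_odd_root:
  fixes A :: "bit mat"
  assumes A: "A \<in> carrier_mat n n" and nil: "A * (A + 1\<^sub>m n) ^\<^sub>m r = 0\<^sub>m n n" and k: "odd k"
  shows "\<exists>C \<in> carrier_mat n n. A = C ^\<^sub>m k"
proof -
  define q :: nat where "q = 2 ^ r"
  have A1: "A + 1\<^sub>m n \<in> carrier_mat n n" using A by simp
  have Aq: "A ^\<^sub>m q \<in> carrier_mat n n" using A by simp
  \<comment> \<open>Since r \<le> 2^r, the annihilating factor survives when its exponent is raised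
    to a power of 2, where Frobenius applies.\<close>
  have "q = r + (q - r)" using less_exp[of r] by (simp add: q_def)
  then have "A * (A + 1\<^sub>m n) ^\<^sub>m q = A * ((A + 1\<^sub>m n) ^\<^sub>m r * (A + 1\<^sub>m n) ^\<^sub>m (q - r))"
    using pow_mat_add[OF A1] by metis
  also have "\<dots> = 0\<^sub>m n n"
    using A A1 nil by (simp add: assoc_mult_mat[of _ n n _ n _ n, symmetric])
  finally have zero: "A * A ^\<^sub>m q + A = 0\<^sub>m n n"
    using A Aq bit_mat_plus_one_pow_two_pow[OF A, of r]
    by (simp add: q_def mult_add_distrib_mat[of _ n n _ n])
  have fix1: "A * A ^\<^sub>m q = A"
  proof (rule eq_matI)
    fix i j assume ij: "i < dim_row A" "j < dim_col A"
    have "(A * A ^\<^sub>m q + A) $$ (i, j) = 0" using zero ij A by simp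
    then have "(A * A ^\<^sub>m q) $$ (i, j) + A $$ (i, j) = 0"
      using ij A by (simp del: index_mult_mat(1) add_bit_eq_xor)
    moreover have "x = y" if "x + y = 0" for x y :: bit
      using that by (cases x; cases y) auto
    ultimately show "(A * A ^\<^sub>m q) $$ (i, j) = A $$ (i, j)" by blast
  qed (use A in auto)
  have fix_pow: "A ^\<^sub>m (1 + q * t) = A" for t
  proof (induction t)
    case 0
    show ?case using A by simp
  next
    case (Suc t)
    have "1 + q * Suc t = (1 + q * t) + q" by simp
    then have "A ^\<^sub>m (1 + q * Suc t) = A ^\<^sub>m (1 + q * t) * A ^\<^sub>m q"
      using pow_mat_add[OF A] by metis
    then show ?case using Suc fix1 by simp
  qed
  have "coprime k q" using k by (simp add: q_def)
  moreover have "k \<noteq> 0" using k by (intro notI) simp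
  \<comment> \<open>Exponents congruent to 1 modulo \<open>q\<close> fix \<open>A\<close>, so
    inverting \<open>k\<close> modulo \<open>q\<close> makes \<open>A ^\<^sub>m x\<close> the
    root.\<close>
  ultimately obtain x y where "k * x = q * y + 1"
    using bezout_nat[of k q] by auto
  then have "(A ^\<^sub>m x) ^\<^sub>m k = A"
    using fix_pow[of y] pow_mat_mult[OF A, of x k] by (simp add: mult.commute)
  then show ?thesis using A by (intro bexI[of _ "A ^\<^sub>m x"]) auto
qed

text \<open>Entries of \<open>X ^\<^sub>m r\<close> sum over walks of length \<open>r\<close>. A
  walk starting in \<open>S\<close> stays there and lowers \<open>\<rho>\<close> at each step, so it
  has at most \<open>\<rho> i\<close> steps.\<close>

lemma pow_mat_row_zero:
  fixes X :: "'a :: semiring_1 mat" and \<rho> :: "nat \<Rightarrow> nat"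
  assumes X: "X \<in> carrier_mat n n"
    and dec: "\<And>i j. i < n \<Longrightarrow> j < n \<Longrightarrow> i \<in> S \<Longrightarrow> X $$ (i, j) \<noteq> 0 \<Longrightarrow> j \<in> S \<and> \<rho> j < \<rho> i"
    and "i < n" "j < n" "i \<in> S" "\<rho> i < r"
  shows "(X ^\<^sub>m r) $$ (i, j) = 0"
  using assms(3-)
proof (induction r arbitrary: i)
  case 0
  then show ?case by simp
next
  case (Suc r)
  have Xr: "X ^\<^sub>m r \<in> carrier_mat n n" using X by simp
  have "X ^\<^sub>m Suc r = X * X ^\<^sub>m r"
    using pow_mat_add[OF X, of 1 r] X by simp
  then have "(X ^\<^sub>m Suc r) $$ (i, j) = (\<Sum>l<n. X $$ (i, l) * (X ^\<^sub>m r) $$ (l, j))"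
    using X Xr Suc.prems by (simp add: scalar_prod_def atLeast0LessThan)
  also have "\<dots> = 0"
  proof (rule sum.neutral, rule ballI)
    fix l assume l: "l \<in> {..<n}"
    show "X $$ (i, l) * (X ^\<^sub>m r) $$ (l, j) = 0"
    proof (cases "X $$ (i, l) = 0")
      case False
      then have "l \<in> S" "\<rho> l < \<rho> i" using dec[of i l] l Suc.prems by auto
      then show ?thesis using Suc.IH[of l] l Suc.prems by simp
    qed simp
  qed
  finally show ?case .
qed

text \<open>The rows of \<open>A + 1\<^sub>m n\<close> indexed by \<open>S\<close> strictly lower
  \<open>\<rho>\<close>, so they vanish in a high power. Left multiplication by \<open>A\<close>
  sees only these rows, because the columns of \<open>A\<close> outside \<open>S\<close> are
  zero.\<close>

lemma bit_mat_odd_root_of_triangular: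
  fixes A :: "bit mat" and \<rho> :: "nat \<Rightarrow> nat"
  assumes A: "A \<in> carrier_mat n n"
    and supp: "\<And>i j. i < n \<Longrightarrow> j < n \<Longrightarrow> A $$ (i, j) \<noteq> 0 \<Longrightarrow> j \<in> S"
    and diag: "\<And>i. i < n \<Longrightarrow> i \<in> S \<Longrightarrow> A $$ (i, i) = 1"
    and dec: "\<And>i j. i < n \<Longrightarrow> j < n \<Longrightarrow> i \<noteq> j \<Longrightarrow> i \<in> S \<Longrightarrow> A $$ (i, j) \<noteq> 0 \<Longrightarrow> \<rho> j < \<rho> i"
    and k: "odd k"
  shows "\<exists>C \<in> carrier_mat n n. A = C ^\<^sub>m k"
proof (rule bit_mat_odd_root[OF A _ k])
  let ?X = "A + 1\<^sub>m n"
  define r where "r = Suc (\<Sum>i<n. \<rho> i)"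
  have X: "?X \<in> carrier_mat n n" using A by simp
  have Xr: "?X ^\<^sub>m r \<in> carrier_mat n n" using X by simp
  have bound: "\<rho> i < r" if "i < n" for i
    using that member_le_sum[of i "{..<n}" \<rho>] by (simp add: r_def)
  have step: "j \<in> S \<and> \<rho> j < \<rho> i" if "i < n" "j < n" "i \<in> S" "?X $$ (i, j) \<noteq> 0" for i j
  proof (cases "i = j")
    case True
    then show ?thesis using that A diag[of i] by simp
  next
    case False
    then show ?thesis using that A supp[of i j] dec[of i j] by simp
  qed
  have rows: "(?X ^\<^sub>m r) $$ (l, j) = 0" if "l < n" "j < n" "l \<in> S" for l j
    using pow_mat_row_zero[OF X step that(1,2,3) bound[OF that(1)]] by blast
  show "A * ?X ^\<^sub>m r = 0\<^sub>m n n"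
  proof (rule eq_matI)
    fix i j assume "i < dim_row (0\<^sub>m n n :: bit mat)" "j < dim_col (0\<^sub>m n n :: bit mat)"
    then have ij: "i < n" "j < n" by auto
    have "(A * ?X ^\<^sub>m r) $$ (i, j) = (\<Sum>l<n. A $$ (i, l) * (?X ^\<^sub>m r) $$ (l, j))"
      using A Xr ij by (simp add: scalar_prod_def atLeast0LessThan)
    also have "\<dots> = 0"
      using supp rows ij by (intro sum.neutral) (metis lessThan_iff mult_eq_0_iff)
    finally show "(A * ?X ^\<^sub>m r) $$ (i, j) = 0\<^sub>m n n $$ (i, j)" using ij by simp
  qed (use A Xr in auto)
qed

lemma sum_of_odd_powers_identity_block:
  fixes M :: "bit mat"
  assumes M: "M \<in> carrier_mat n n" and k: "odd k"
    and block: "\<And>i j. i < n \<Longrightarrow> j < n \<Longrightarrow> i \<noteq> j \<Longrightarrow>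
      M $$ (i, i) = 1 \<Longrightarrow> M $$ (j, j) = 1 \<Longrightarrow> M $$ (i, j) = 0"
  shows "\<exists>A \<in> carrier_mat n n. \<exists>B \<in> carrier_mat n n. M = A ^\<^sub>m k + B ^\<^sub>m k"
proof -
  define S where "S = {i. M $$ (i, i) = 0}"
  \<comment> \<open>The blocks are cut out by membership in \<open>S\<close>, without reordering the
    basis. On the diagonal in \<open>S\<close>, the two ones add up to 0.\<close>
  define U where "U = mat n n (\<lambda>(i, j). if i = j then 1
    else if i \<in> S \<and> (j \<in> S \<longrightarrow> i < j) then M $$ (i, j) else 0)"
  define L where "L = mat n n (\<lambda>(i, j). if i = j then (if i \<in> S then 1 else 0)
    else if j \<in> S \<and> (i \<in> S \<longrightarrow> j < i) then M $$ (i, j) else 0)"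
  have U: "U \<in> carrier_mat n n" and L: "L \<in> carrier_mat n n"
    by (simp_all add: U_def L_def)
  have "M = U + L"
  proof (rule eq_matI)
    fix i j assume "i < dim_row (U + L)" "j < dim_col (U + L)"
    then have ij: "i < n" "j < n" using L by auto
    have "M $$ (i, j) = 0" if "i \<noteq> j" "i \<notin> S" "j \<notin> S"
      using block[of i j] that ij by (auto simp: S_def)
    then show "M $$ (i, j) = (U + L) $$ (i, j)"
      using ij by (auto simp: U_def L_def S_def)
  qed (use M L in auto)
  moreover have "\<exists>A \<in> carrier_mat n n. U = A ^\<^sub>m k"
    \<comment> \<open>The rank falls to the right within \<open>S\<close> and puts all other indices
      last; their rows in \<open>U\<close> are identity rows.\<close>
    by (rule bit_mat_odd_root_of_triangular[OF U, of UNIV "\<lambda>i. if i \<in> S then n - i else 0"])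
      (auto simp: U_def k split: if_splits)
  moreover have "\<exists>B \<in> carrier_mat n n. L = B ^\<^sub>m k"
    by (rule bit_mat_odd_root_of_triangular[OF L, of S id])
      (auto simp: L_def k split: if_splits)
  ultimately show ?thesis by blast
qed

text \<open>Conjugation is additive and commutes with powers.\<close>

lemma sum_of_powers_similar:
  fixes M M' :: "'a :: comm_ring_1 mat"
  assumes M: "M \<in> carrier_mat n n" and sim: "similar_mat M M'"
    and sums: "\<exists>A \<in> carrier_mat n n. \<exists>B \<in> carrier_mat n n. M' = A ^\<^sub>m k + B ^\<^sub>m k"
  shows "\<exists>A \<in> carrier_mat n n. \<exists>B \<in> carrier_mat n n. M = A ^\<^sub>m k + B ^\<^sub>m k"
proof -
  obtain P Q where "similar_mat_wit M M' P Q" using sim by (auto simp: similar_mat_def)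
  note wit = similar_mat_witD2[OF M this]
  have P: "P \<in> carrier_mat n n" and Q: "Q \<in> carrier_mat n n" using wit by auto
  obtain A B where A: "A \<in> carrier_mat n n" and B: "B \<in> carrier_mat n n"
    and M': "M' = A ^\<^sub>m k + B ^\<^sub>m k"
    using sums by blast
  have conj: "(P * C * Q) ^\<^sub>m k = P * C ^\<^sub>m k * Q" if "C \<in> carrier_mat n n" for C
    by (rule similar_mat_wit_pow_id, rule similar_mat_witI[of _ _ n]) (use wit that P Q in auto)
  have "M = (P * A * Q) ^\<^sub>m k + (P * B * Q) ^\<^sub>m k"
    using wit(3) A B P Q unfolding conj[OF A] conj[OF B]
    by (simp add: M' mult_add_distrib_mat[of _ n n _ n] add_mult_distrib_mat[of _ n n _ _ n])
  then show ?thesis using A B P Q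
    by (intro bexI[of _ "P * A * Q"] bexI[of _ "P * B * Q"]) auto
qed

theorem theorem1p4:
  fixes n k :: nat and M :: "bit mat"
  assumes "n \<ge> 2" and "odd k"
    and "M \<in> carrier_mat n n"
  shows "\<exists>A \<in> carrier_mat n n. \<exists>B \<in> carrier_mat n n. M = A ^\<^sub>m k + B ^\<^sub>m k"
  using assms(3)
proof (induction "card {i. i < n \<and> M $$ (i, i) = 1}" arbitrary: M rule: less_induct)
  case less
  note M = less.prems
  show ?case
  proof (cases "\<exists>i j. i < n \<and> j < n \<and> i \<noteq> j \<and>
      M $$ (i, i) = 1 \<and> M $$ (j, j) = 1 \<and> M $$ (i, j) = 1")
    case True
    then obtain l m where lm: "l < n" "m < n" "l \<noteq> m"
      and ones: "M $$ (l, l) = 1" "M $$ (m, m) = 1" "M $$ (l, m) = 1"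
      by blast
    \<comment> \<open>This conjugation adds column \<open>m\<close> to column \<open>l\<close> and
      subtracts row \<open>l\<close> from row \<open>m\<close>, so \<open>M $$ (l, m) = 1\<close>
      clears both diagonal ones.\<close>
    define M' where "M' = add_col_sub_row 1 m l M"
    have M': "M' \<in> carrier_mat n n" using M by (simp add: M'_def)
    have diag: "M' $$ (i, i) = (if i = l \<or> i = m then 0 else M $$ (i, i))" if "i < n" for i
      using that M lm ones by (auto simp: M'_def)
    have "M $$ (i, i) = 1" if "i < n" "M' $$ (i, i) = 1" for i
      using that(2) unfolding diag[OF that(1)] by (cases "i = l \<or> i = m") simp_all
    moreover have "M' $$ (l, l) \<noteq> 1" using diag[OF lm(1)] by simp
    ultimately have "{i. i < n \<and> M' $$ (i, i) = 1} \<subset> {i. i < n \<and> M $$ (i, i) = 1}"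
      using lm(1) ones(1) by blast
    then have "card {i. i < n \<and> M' $$ (i, i) = 1} < card {i. i < n \<and> M $$ (i, i) = 1}"
      by (intro psubset_card_mono) auto
    then have "\<exists>A \<in> carrier_mat n n. \<exists>B \<in> carrier_mat n n. M' = A ^\<^sub>m k + B ^\<^sub>m k"
      using less.hyps M' by blast
    moreover have "similar_mat M M'"
      unfolding M'_def by (rule similar_mat_sym, rule add_col_sub_row_similar[OF M]) (use lm in auto)
    ultimately show ?thesis using sum_of_powers_similar[OF M] by blast
  next
    case False
    show ?thesis
      by (rule sum_of_odd_powers_identity_block[OF M assms(2)]) (use False bit_not_one_iff in blast)
  qed
qed

end
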